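(* Let $G$ be a finite simple graph with maximum degree $\Delta_G$, and let $L$ be the square of the line graph of $G$. Then the clique number $\omega(L)$ of $L$ is at most $1.5\,\Delta_G^2$.
   Context: The line graph of $G$ is the graph whose vertices are the edges of $G$, two being adjacent iff the corresponding edges of $G$ share an endpoint. The square of a graph $H$ is the graph on $V(H)$ in which two distinct vertices are adjacent iff their distance in $H$ is at most $2$. Equivalently, a clique in $L$ is a set of edges of $G$ such that any two of them either share an endpoint or are joined by an edge of $G$ (i.e. some endpoint of one is adjacent in $G$ to some endpoint of the other). The clique number $\omega(L)$ is the maximum size of a clique in $L$. *)

theory Defs
  imports "Graph_Theory.Pair_Digraph" "Graph_Theory.Shortest_Path"
begin

text \<open>
  A finite simple graph is a \<open>pair_graph\<close>: a finite vertex set \<open>pverts G\<close> together with a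
  finite, symmetric and irreflexive adjacency relation \<open>parcs G\<close> on it. An undirected edge
  thus corresponds to two opposite arcs, and the out-degree of a vertex is its degree.
\<close>

definition edges :: "'a pair_pre_digraph \<Rightarrow> 'a set set" where
  "edges G = {{u, v} | u v. (u, v) \<in> parcs G}"

text \<open>Inserting \<open>0\<close> only affects the graph without vertices, whose maximum degree is \<open>0\<close>.\<close>

definition max_degree :: "'a pair_pre_digraph \<Rightarrow> nat" where
  "max_degree G = Max (insert 0 ((\<lambda>v. out_degree (with_proj G) v) ` pverts G))"

definition line_graph :: "'a pair_pre_digraph \<Rightarrow> 'a set pair_pre_digraph" where
  "line_graph G =
    \<lparr> pverts = edges G,
      parcs = {(e, f). e \<in> edges G \<and> f \<in> edges G \<and> e \<noteq> f \<and> e \<inter> f \<noteq> {}} \<rparr>"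

text \<open>
  The distance is the infimum of the number of arcs over all walks, and is infinite for
  vertices in different components.
\<close>

definition graph_dist :: "'a pair_pre_digraph \<Rightarrow> 'a \<Rightarrow> 'a \<Rightarrow> ereal" where
  "graph_dist H u v = wf_digraph.\<mu> (with_proj H) (\<lambda>_. 1) u v"

definition graph_square :: "'a pair_pre_digraph \<Rightarrow> 'a pair_pre_digraph" where
  "graph_square H =
    \<lparr> pverts = pverts H,
      parcs = {(u, v). u \<in> pverts H \<and> v \<in> pverts H \<and> u \<noteq> v \<and> graph_dist H u v \<le> 2} \<rparr>"

definition is_clique :: "'a pair_pre_digraph \<Rightarrow> 'a set \<Rightarrow> bool" where
  "is_clique H C \<longleftrightarrow>
    C \<subseteq> pverts H \<and> (\<forall>u\<in>C. \<forall>v\<in>C. u \<noteq> v \<longrightarrow> (u, v) \<in> parcs H)"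

definition clique_number :: "'a pair_pre_digraph \<Rightarrow> nat" where
  "clique_number H = Max {card C | C. is_clique H C}"

text \<open>
  The constants of the locale \<open>wf_digraph\<close>, and hence \<open>graph_dist\<close>, are only specified for
  well-formed graphs; \<open>Max\<close> is only meaningful for finite nonempty sets. The following facts
  show that both are used within their domain.
\<close>

lemma finite_edges:
  assumes "pair_graph G"
  shows "finite (edges G)"
proof -
  interpret pair_graph G by fact
  have "edges G = (\<lambda>(u, v). {u, v}) ` parcs G"
    by (auto simp: edges_def)
  then show ?thesis
    using pair_finite_arcs by simp
qed

lemma pair_graphI:
  assumes "finite (pverts H)" "parcs H \<subseteq> pverts H \<times> pverts H" "sym (parcs H)" "irrefl (parcs H)"
  shows "pair_graph H"
proof
  show "finite (parcs H)"
    using assms(1,2) by (meson finite_SigmaI finite_subset)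
  show "symmetric (with_proj H)"
    using assms(3) by (simp add: symmetric_def)
qed (use assms in \<open>auto simp: irrefl_def\<close>)

lemma pair_graph_line_graph:
  assumes "pair_graph G"
  shows "pair_graph (line_graph G)"
  by (rule pair_graphI) (use finite_edges[OF assms] in \<open>auto simp: line_graph_def sym_def irrefl_def\<close>)

lemma graph_dist_le_2_iff:
  assumes "pair_graph H" "u \<in> pverts H"
  shows "graph_dist H u v \<le> 2 \<longleftrightarrow>
    u = v \<or> (u, v) \<in> parcs H \<or> (\<exists>w. (u, w) \<in> parcs H \<and> (w, v) \<in> parcs H)"
    (is "_ \<longleftrightarrow> ?R")
proof -
  interpret pair_graph H by fact
  have cost: "awalk_cost (\<lambda>_. 1) p = real (length p)" for p
    by (induction p) auto
  have dist: "graph_dist H u v = (INF p\<in>{p. awalk u p v}. ereal (real (length p)))"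
    by (simp add: graph_dist_def \<mu>_def cost)
  show ?thesis
  proof
    assume "graph_dist H u v \<le> 2"
    then have "graph_dist H u v < ereal 3"
      by (rule order_le_less_trans) simp
    then obtain p where p: "awalk u p v" "length p < 3"
      unfolding dist INF_less_iff by auto
    then consider "p = []" | a where "p = [a]" | a b where "p = [a, b]"
      by (cases p rule: remdups_adj.cases) (auto simp: less_Suc_eq numeral_3_eq_3)
    then show ?R
      using p(1) by cases (auto simp: awalk_simps)
  next
    have le: "graph_dist H u v \<le> 2" if "awalk u p v" "length p \<le> 2" for p
    proof -
      have "graph_dist H u v \<le> ereal (real (length p))"
        unfolding dist using that(1) by (intro INF_lower) simp
      also have "\<dots> \<le> ereal 2"
        using that(2) by simp
      finally show ?thesis by simp
    qed
    assume ?R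
    then consider "u = v" | "(u, v) \<in> parcs H"
      | w where "(u, w) \<in> parcs H" "(w, v) \<in> parcs H"
      by blast
    then show "graph_dist H u v \<le> 2"
    proof cases
      case 1
      then show ?thesis using assms(2) by (intro le[of "[]"]) (auto simp: awalk_simps)
    next
      case 2
      then show ?thesis
        by (intro le[of "[(u, v)]"]) (auto simp: awalk_simps dest: in_arcsD1 in_arcsD2)
    next
      case 3
      then show ?thesis
        by (intro le[of "[(u, w), (w, v)]"]) (auto simp: awalk_simps dest: in_arcsD1 in_arcsD2)
    qed
  qed
qed

lemma pair_graph_graph_square:
  assumes "pair_graph H"
  shows "pair_graph (graph_square H)"
proof -
  interpret pair_graph H by fact
  have sym: "(y, x) \<in> parcs H \<longleftrightarrow> (x, y) \<in> parcs H" for x y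
    using pair_sym_arcs by (auto simp: symmetric_def dest: symD)
  have dist_sym: "graph_dist H y x \<le> 2"
    if xy: "x \<in> pverts H" "y \<in> pverts H" "graph_dist H x y \<le> 2" for x y
    using xy(3) unfolding graph_dist_le_2_iff[OF assms xy(1)] graph_dist_le_2_iff[OF assms xy(2)]
    by (metis sym)
  show ?thesis
  proof (rule pair_graphI)
    show "sym (parcs (graph_square H))"
      unfolding graph_square_def by (rule symI) (use dist_sym in auto)
  qed (use pair_finite_verts in \<open>auto simp: graph_square_def irrefl_def\<close>)
qed

lemma finite_clique_cards:
  assumes "pair_graph H"
  shows "finite {card C | C. is_clique H C}" "{card C | C. is_clique H C} \<noteq> {}"
proof -
  interpret pair_graph H by fact
  have "{card C | C. is_clique H C} \<subseteq> card ` Pow (pverts H)"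
    by (auto simp: is_clique_def)
  then show "finite {card C | C. is_clique H C}"
    using pair_finite_verts by (meson finite_Pow_iff finite_imageI finite_subset)
  have "is_clique H {}"
    by (simp add: is_clique_def)
  then show "{card C | C. is_clique H C} \<noteq> {}"
    by blast
qed

end

theory Submission
  imports Defs
begin

text \<open>
  Let \<open>C\<close> be a clique of the square of the line graph, \<open>h\<close> the maximum degree of the graph
  formed by the edges in \<open>C\<close>, \<open>v\<close> a vertex attaining it, and \<open>A\<close> the set of its \<open>h\<close>
  neighbours along \<open>C\<close>. At most \<open>(\<Delta> - h) h\<close> edges of \<open>C\<close> meet a neighbour of \<open>v\<close>
  outside \<open>A\<close>. Write \<open>g x\<close> and \<open>k x\<close> for the number of neighbours of \<open>x\<close> in \<open>A\<close> in
  \<open>G\<close> and along \<open>C\<close>, respectively. Then at most \<open>\<Sum>x. k x\<close> edges of \<open>C\<close> meet \<open>A\<close>.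
  An edge \<open>{a, b}\<close> of \<open>C\<close> that avoids the neighbours of \<open>v\<close> must be joined to each of the
  \<open>h\<close> edges of \<open>C\<close> at \<open>v\<close>, so \<open>g a + g b \<ge> h\<close>. Weighting \<open>x\<close> by
  \<open>\<phi> = min 1 (g x / (2 (h - g x)))\<close> gives each such edge total weight at least \<open>1\<close>, by
  AM-GM, while at most \<open>h - k x\<close> of these edges contain \<open>x\<close>. Since
  \<open>k x + \<phi> (h - k x) \<le> 3/2 g x\<close> and \<open>\<Sum>x. g x \<le> h \<Delta>\<close>, altogether
  \<open>|C| \<le> (\<Delta> - h) h + 3/2 h \<Delta> \<le> 3/2 \<Delta>\<^sup>2\<close>.
\<close>

text \<open>The case distinction also avoids the junk value of the quotient at \<open>g = h\<close>.\<close>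

definition weight :: "real \<Rightarrow> real \<Rightarrow> real" where
  "weight h g = (if 2 * h \<le> 3 * g then 1 else g / (2 * (h - g)))"

lemma weight_nonneg:
  assumes "0 \<le> g" "g \<le> h"
  shows "0 \<le> weight h g"
  using assms by (simp add: weight_def)

text \<open>A capped weight already suffices. Otherwise \<open>h \<le> a + b\<close> says that
  \<open>h - b \<le> a\<close> and \<open>h - a \<le> b\<close>, so twice the sum is at least
  \<open>q / p + p / q\<close>, which is at least 2.\<close>

lemma weight_add_ge_1:
  assumes "0 \<le> a" "a \<le> h" "0 \<le> b" "b \<le> h" "h \<le> a + b"
  shows "1 \<le> weight h a + weight h b"
proof (cases "2 * h \<le> 3 * a \<or> 2 * h \<le> 3 * b")
  case True
  then show ?thesis
    using weight_nonneg[OF assms(1,2)] weight_nonneg[OF assms(3,4)] by (auto simp: weight_def)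
next
  case False
  define p q where "p = h - a" and "q = h - b"
  have pq: "0 < p" "0 < q" "q \<le> a" "p \<le> b"
    using False assms by (auto simp: p_def q_def)
  have "2 \<le> q / p + p / q"
    using pq sum_squares_bound[of p q] by (simp add: field_simps power2_eq_square)
  also have "\<dots> \<le> a / p + b / q"
    using pq by (intro add_mono divide_right_mono) auto
  also have "\<dots> = 2 * (weight h a + weight h b)"
    using False pq(1,2) by (simp add: weight_def p_def[symmetric] q_def[symmetric] field_simps)
  finally show ?thesis by simp
qed

text \<open>The weight is at most 1, so the left side is nondecreasing in \<open>k\<close> and
  \<open>k = g\<close> is the worst case. The uncapped weight is chosen to give equality
  there.\<close>

lemma add_weight_mult_le:
  assumes "0 \<le> k" "k \<le> g" "g \<le> h"
  shows "k + weight h g * (h - k) \<le> 3 / 2 * g"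
proof (cases "2 * h \<le> 3 * g")
  case True
  then show ?thesis by (simp add: weight_def)
next
  case False
  let ?w = "weight h g"
  have w: "?w * (h - g) = g / 2"
    using False assms by (simp add: weight_def field_simps)
  have "?w \<le> 1"
    using False assms by (simp add: weight_def field_simps)
  then have "k * (1 - ?w) \<le> g * (1 - ?w)"
    using assms by (intro mult_right_mono) auto
  then show ?thesis
    using w by (simp add: algebra_simps)
qed

text \<open>The combinatorial core, stated for a bare relation so that walks, distances and line
  graphs stay out of the counting.\<close>

lemma strong_clique_card_le:
  fixes E :: "('a \<times> 'a) set" and C :: "'a set set" and d :: nat
  assumes fin: "finite E" and E: "sym E" "irrefl E"
    and deg: "\<And>x. card (E `` {x}) \<le> d"
    and CE: "C \<subseteq> {{x, y} | x y. (x, y) \<in> E}"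
    and joined: "\<And>e f. e \<in> C \<Longrightarrow> f \<in> C \<Longrightarrow> e \<inter> f = {} \<Longrightarrow> \<exists>x\<in>e. \<exists>y\<in>f. (x, y) \<in> E"
  shows "real (card C) \<le> 3 / 2 * (real d)\<^sup>2"
proof (cases "C = {}")
  case True
  then show ?thesis by simp
next
  case False
  define R where "R = {(x, y). {x, y} \<in> C}"
  define V where "V = Domain E"
  have symE: "(x, y) \<in> E \<longleftrightarrow> (y, x) \<in> E" for x y
    using E by (meson symD)
  have symR: "(x, y) \<in> R \<longleftrightarrow> (y, x) \<in> R" for x y
    by (simp add: R_def insert_commute)
  have RE: "R \<subseteq> E"
  proof (rule subrelI)
    fix x y assume "(x, y) \<in> R"
    then obtain a b where "{x, y} = {a, b}" "(a, b) \<in> E"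
      using CE unfolding R_def by blast
    then show "(x, y) \<in> E"
      using symE unfolding doubleton_eq_iff by blast
  qed
  have C_cases: "\<exists>x y. e = {x, y} \<and> x \<noteq> y \<and> (x, y) \<in> R" if eC: "e \<in> C" for e
  proof -
    obtain x y where "e = {x, y}" "(x, y) \<in> E"
      using eC CE by blast
    then show ?thesis
      using eC E(2) unfolding R_def irrefl_def by blast
  qed
  have finV: "finite V"
    using fin by (simp add: V_def finite_Domain)
  have fin_nbrs: "finite (E `` X)" for X
    by (rule finite_subset[OF _ finite_Range[OF fin]]) auto
  have finR: "finite (R `` X)" for X
    using RE fin_nbrs[of X] by (meson Image_mono finite_subset subset_refl)
  have "V \<noteq> {}"
    using False C_cases RE unfolding V_def by blast
  define h where "h = Max ((\<lambda>x. card (R `` {x})) ` V)"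
  obtain v where v: "v \<in> V" "card (R `` {v}) = h"
    using Max_in[of "(\<lambda>x. card (R `` {x})) ` V"] finV \<open>V \<noteq> {}\<close> unfolding h_def
    by (metis (no_types, lifting) finite_imageI image_iff image_is_empty)
  have R_le: "card (R `` {x}) \<le> h" for x
  proof (cases "x \<in> V")
    case True
    then show ?thesis unfolding h_def using finV by simp
  next
    case False
    then have "R `` {x} = {}" using RE by (auto simp: V_def)
    then show ?thesis by simp
  qed
  have "h \<le> d"
    using v(2) deg[of v] card_mono[OF fin_nbrs Image_mono[OF RE subset_refl], of "{v}"] by simp
  define A where "A = R `` {v}"
  define N where "N = E `` {v}"
  define g where "g x = card (E `` {x} \<inter> A)" for x
  define k where "k x = card (R `` {x} \<inter> A)" for x
  define F where "F = {e \<in> C. e \<inter> N = {}}"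
  let ?w = "\<lambda>x. weight (real h) (real (g x))"
  have AN: "A \<subseteq> N" and finA: "finite A" and finN: "finite N" and cardA: "card A = h"
    using RE finR fin_nbrs v by (auto simp: A_def N_def)
  have kg: "k x \<le> g x" and gh: "g x \<le> h" for x
    using RE finA cardA by (auto simp: k_def g_def intro!: card_mono)
  have finC: "finite C"
  proof (rule finite_subset)
    show "C \<subseteq> (\<lambda>(x, y). {x, y}) ` E" using CE by auto
  qed (use fin in simp)
  have finF: "finite F"
    using finC by (simp add: F_def)

  \<comment> \<open>Edges of \<open>C\<close> that meet \<open>N\<close>\<close>
  let ?B = "\<Union>u\<in>N - A. (\<lambda>y. {u, y}) ` (R `` {u})"
  let ?A = "\<Union>x\<in>V. (\<lambda>u. {x, u}) ` (R `` {x} \<inter> A)"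
  have "card ?B \<le> (\<Sum>u\<in>N - A. card ((\<lambda>y. {u, y}) ` (R `` {u})))"
    using finN by (intro card_UN_le) simp
  also have "\<dots> \<le> (\<Sum>u\<in>N - A. h)"
    by (intro sum_mono order_trans[OF card_image_le R_le] finR)
  also have "\<dots> \<le> (d - h) * h"
    using deg[of v] AN finA cardA by (simp add: N_def[symmetric] card_Diff_subset diff_le_mono)
  finally have card_B: "card ?B \<le> (d - h) * h" .
  have "card ?A \<le> (\<Sum>x\<in>V. card ((\<lambda>u. {x, u}) ` (R `` {x} \<inter> A)))"
    using finV by (rule card_UN_le)
  also have "\<dots> \<le> (\<Sum>x\<in>V. k x)"
    unfolding k_def using finA by (intro sum_mono card_image_le) simp
  finally have card_A: "card ?A \<le> (\<Sum>x\<in>V. k x)" .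

  \<comment> \<open>Edges of \<open>C\<close> that avoid \<open>N\<close>\<close>
  have F_weight: "1 \<le> (\<Sum>x\<in>e. ?w x)" if "e \<in> F" for e
  proof -
    have eC: "e \<in> C" and eN: "e \<inter> N = {}"
      using that by (auto simp: F_def)
    obtain a b where ab: "e = {a, b}" "a \<noteq> b" "(a, b) \<in> R"
      using C_cases[OF eC] by blast
    have "v \<notin> e"
      using ab eN RE symE by (auto simp: N_def)
    have "A \<subseteq> (E `` {a} \<inter> A) \<union> (E `` {b} \<inter> A)"
    proof
      fix u assume "u \<in> A"
      then have "{v, u} \<in> C" "u \<in> N"
        using AN by (auto simp: A_def R_def)
      moreover have "{v, u} \<inter> e = {}"
        using \<open>v \<notin> e\<close> \<open>u \<in> N\<close> eN by auto
      ultimately obtain x y where "x \<in> {v, u}" "y \<in> e" "(x, y) \<in> E"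
        using joined eC by blast
      \<comment> \<open>The case \<open>x = v\<close> would put \<open>y\<close> into
        \<open>N\<close>, which \<open>e\<close> avoids.\<close>
      then have "(u, y) \<in> E"
        using eN by (auto simp: N_def)
      then show "u \<in> (E `` {a} \<inter> A) \<union> (E `` {b} \<inter> A)"
        using \<open>u \<in> A\<close> \<open>y \<in> e\<close> ab symE by auto
    qed
    then have "card A \<le> card ((E `` {a} \<inter> A) \<union> (E `` {b} \<inter> A))"
      using finA by (intro card_mono) auto
    then have "h \<le> g a + g b"
      unfolding g_def cardA using card_Un_le order_trans by blast
    then have "1 \<le> ?w a + ?w b"
      using gh by (intro weight_add_ge_1) (simp_all flip: of_nat_add)
    then show ?thesis
      using ab by simp
  qed
  have F_deg: "card {e \<in> F. x \<in> e} \<le> h - k x" for x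
  proof -
    \<comment> \<open>The other endpoint of an edge in \<open>F\<close> lies outside
      \<open>N\<close>, hence outside \<open>A\<close>.\<close>
    have "{e \<in> F. x \<in> e} \<subseteq> (\<lambda>y. {x, y}) ` (R `` {x} - A)"
    proof
      fix e assume e: "e \<in> {e \<in> F. x \<in> e}"
      then have "e \<in> C" by (simp add: F_def)
      then obtain a b where "e = {a, b}" "(a, b) \<in> R"
        using C_cases by blast
      then obtain y where "e = {x, y}" "(x, y) \<in> R"
        using e symR by (auto simp: insert_commute)
      then show "e \<in> (\<lambda>y. {x, y}) ` (R `` {x} - A)"
        using e AN by (auto simp: F_def)
    qed
    then have "card {e \<in> F. x \<in> e} \<le> card (R `` {x} - A)"
      by (rule surj_card_le[rotated]) (simp add: finR)
    also have "\<dots> = card (R `` {x}) - k x"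
      using finA by (simp add: k_def card_Diff_subset_Int)
    also have "\<dots> \<le> h - k x"
      using R_le by (rule diff_le_mono)
    finally show ?thesis .
  qed
  have "real (card F) \<le> (\<Sum>e\<in>F. \<Sum>x\<in>e. ?w x)"
    using sum_mono[of F "\<lambda>_. 1", OF F_weight] by simp
  also have "\<dots> = (\<Sum>e\<in>F. \<Sum>x | x \<in> V \<and> x \<in> e. ?w x)"
  proof (intro sum.cong refl)
    fix e assume "e \<in> F"
    then obtain x y where "e = {x, y}" "(x, y) \<in> E"
      using CE unfolding F_def by blast
    then show "e = {x. x \<in> V \<and> x \<in> e}"
      using symE unfolding V_def by blast
  qed
  also have "\<dots> = (\<Sum>x\<in>V. \<Sum>e | e \<in> F \<and> x \<in> e. ?w x)"
    by (rule sum.swap_restrict) (use finF finV in auto)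
  also have "\<dots> \<le> (\<Sum>x\<in>V. ?w x * (real h - real (k x)))"
  proof (rule sum_mono)
    fix x
    \<comment> \<open>Since \<open>k x \<le> g x \<le> h\<close>, the natural subtraction in
      \<open>F_deg\<close> does not truncate.\<close>
    have "real (card {e \<in> F. x \<in> e}) \<le> real h - real (k x)"
      using F_deg[of x] order_trans[OF kg gh, of x] by linarith
    then have "?w x * real (card {e \<in> F. x \<in> e}) \<le> ?w x * (real h - real (k x))"
      by (intro mult_left_mono weight_nonneg) (use gh in auto)
    then show "(\<Sum>e | e \<in> F \<and> x \<in> e. ?w x) \<le> ?w x * (real h - real (k x))"
      by (simp add: mult.commute)
  qed
  finally have card_F: "real (card F) \<le> (\<Sum>x\<in>V. ?w x * (real h - real (k x)))" .

  \<comment> \<open>Double counting the arcs into \<open>A\<close>\<close>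
  have "(\<Sum>x\<in>V. g x) = (\<Sum>x\<in>V. \<Sum>u | u \<in> A \<and> (x, u) \<in> E. 1)"
    unfolding g_def by (intro sum.cong) (auto intro: arg_cong[where f = card])
  also have "\<dots> = (\<Sum>u\<in>A. \<Sum>x | x \<in> V \<and> (x, u) \<in> E. 1)"
    by (rule sum.swap_restrict[OF finV finA])
  also have "\<dots> \<le> (\<Sum>u\<in>A. d)"
  proof (rule sum_mono)
    fix u
    have "{x \<in> V. (x, u) \<in> E} = E `` {u}"
      using symE by (auto simp: V_def)
    then show "(\<Sum>x | x \<in> V \<and> (x, u) \<in> E. 1) \<le> d"
      using deg[of u] by simp
  qed
  finally have "(\<Sum>x\<in>V. g x) \<le> h * d"
    by (simp add: cardA)
  then have sum_g: "(\<Sum>x\<in>V. real (g x)) \<le> real h * real d"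
    by (metis of_nat_sum of_nat_mult of_nat_le_iff)

  \<comment> \<open>Assembling the three counts\<close>
  have "C \<subseteq> ?B \<union> ?A \<union> F"
  proof
    fix e assume "e \<in> C"
    show "e \<in> ?B \<union> ?A \<union> F"
    proof (cases "e \<in> F")
      case False
      then obtain u where u: "u \<in> e" "u \<in> N"
        using \<open>e \<in> C\<close> by (auto simp: F_def)
      obtain a b where "e = {a, b}" "(a, b) \<in> R"
        using C_cases[OF \<open>e \<in> C\<close>] by blast
      then obtain y where y: "e = {u, y}" "(u, y) \<in> R"
        using u symR by (auto simp: insert_commute)
      show ?thesis
      proof (cases "u \<in> A")
        case True
        have "y \<in> V" "(y, u) \<in> R"
          using y RE symR by (auto simp: V_def)
        then show ?thesis
          using True y by (auto simp: insert_commute)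
      qed (use u y in auto)
    qed simp
  qed
  then have "card C \<le> card (?B \<union> ?A \<union> F)"
    by (rule card_mono[rotated]) (use finN finV finA finF finR in auto)
  also have "\<dots> \<le> card ?B + card ?A + card F"
    by (meson add_le_mono1 card_Un_le order_trans)
  also have "\<dots> \<le> (d - h) * h + (\<Sum>x\<in>V. k x) + card F"
    using card_A card_B by simp
  finally have "real (card C) \<le> real ((d - h) * h + (\<Sum>x\<in>V. k x) + card F)"
    by (rule of_nat_mono)
  also have "\<dots> \<le> (real d - h) * h + (\<Sum>x\<in>V. real (k x) + ?w x * (real h - real (k x)))"
    using card_F \<open>h \<le> d\<close> by (simp add: of_nat_diff sum.distrib)
  also have "(\<Sum>x\<in>V. real (k x) + ?w x * (real h - real (k x))) \<le> (\<Sum>x\<in>V. 3 / 2 * real (g x))"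
    using kg gh by (intro sum_mono add_weight_mult_le) auto
  also have "\<dots> \<le> 3 / 2 * (real h * real d)"
    unfolding sum_distrib_left[symmetric] using sum_g by (intro mult_left_mono) auto
  \<comment> \<open>The slack factors, and both factors are nonnegative because
    \<open>h \<le> d\<close>.\<close>
  also have "(real d - h) * h + 3 / 2 * (real h * real d)
      = 3 / 2 * (real d)\<^sup>2 - (real d - h) * (3 / 2 * real d - h)"
    by (simp add: field_simps power2_eq_square)
  also have "\<dots> \<le> 3 / 2 * (real d)\<^sup>2"
    using \<open>h \<le> d\<close> by simp
  finally show ?thesis by simp
qed

lemma card_Image_le_max_degree:
  assumes "pair_graph G"
  shows "card (parcs G `` {x}) \<le> max_degree G"
proof -
  interpret pair_graph G by fact
  show ?thesis
  proof (cases "x \<in> pverts G")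
    case True
    have "parcs G `` {x} = snd ` out_arcs (with_proj G) x"
      by (force simp: out_arcs_def)
    then have "card (parcs G `` {x}) \<le> out_degree (with_proj G) x"
      unfolding out_degree_def by (simp add: card_image_le out_arcs_def)
    also have "\<dots> \<le> max_degree G"
      unfolding max_degree_def using True by (intro Max_ge) auto
    finally show ?thesis .
  next
    case False
    then have "parcs G `` {x} = {}"
      using in_arcsD1 by auto
    then show ?thesis by simp
  qed
qed

text \<open>Disjoint edges are not adjacent in the line graph, so some edge \<open>c\<close> meets
  both. Being disjoint, they contain different endpoints of \<open>c\<close>, which is therefore the
  joining edge.\<close>

lemma square_line_graph_arcD:
  assumes "pair_graph G" "(e, f) \<in> parcs (graph_square (line_graph G))" "e \<inter> f = {}"
  shows "\<exists>x\<in>e. \<exists>y\<in>f. (x, y) \<in> parcs G"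
proof -
  interpret pair_graph G by fact
  have sym: "(x, y) \<in> parcs G \<Longrightarrow> (y, x) \<in> parcs G" for x y
    using pair_sym_arcs by (auto simp: symmetric_def dest: symD)
  have "e \<noteq> f" "e \<in> pverts (line_graph G)" "graph_dist (line_graph G) e f \<le> 2"
    using assms(2) by (auto simp: graph_square_def)
  then obtain c where "c \<in> edges G" "e \<inter> c \<noteq> {}" "c \<inter> f \<noteq> {}"
    using assms(3) graph_dist_le_2_iff[OF pair_graph_line_graph[OF assms(1)]]
    by (auto simp: line_graph_def)
  then show ?thesis
    using assms(3) sym by (fastforce simp: edges_def)
qed

theorem theorem2:
  fixes G :: "'a pair_pre_digraph"
  assumes "pair_graph G"
  shows "real (clique_number (graph_square (line_graph G))) \<le> 1.5 * (real (max_degree G))\<^sup>2"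
proof -
  interpret pair_graph G by fact
  let ?L = "graph_square (line_graph G)"
  have "pair_graph ?L"
    by (intro pair_graph_graph_square pair_graph_line_graph assms)
  from Max_in[OF finite_clique_cards[OF this]]
  obtain C where C: "is_clique ?L C" "clique_number ?L = card C"
    unfolding clique_number_def by auto
  have "real (card C) \<le> 3 / 2 * (real (max_degree G))\<^sup>2"
  proof (rule strong_clique_card_le)
    show "finite (parcs G)" by (rule pair_finite_arcs)
    show "sym (parcs G)" using pair_sym_arcs by (simp add: symmetric_def)
    show "irrefl (parcs G)" using pair_no_loops by (fastforce simp: irrefl_def)
    show "card (parcs G `` {x}) \<le> max_degree G" for x
      by (rule card_Image_le_max_degree[OF assms])
    show C_edges: "C \<subseteq> {{x, y} | x y. (x, y) \<in> parcs G}"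
      using C(1) by (auto simp: is_clique_def graph_square_def line_graph_def edges_def)
    show "\<exists>x\<in>e. \<exists>y\<in>f. (x, y) \<in> parcs G" if "e \<in> C" "f \<in> C" "e \<inter> f = {}" for e f
    proof (rule square_line_graph_arcD[OF assms _ that(3)])
      \<comment> \<open>Edges are nonempty, so disjoint ones are distinct.\<close>
      have "e \<noteq> f"
        using that C_edges by blast
      then show "(e, f) \<in> parcs ?L"
        using C(1) that by (auto simp: is_clique_def)
    qed
  qed
  then show ?thesis
    by (simp add: C(2))
qed

end
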